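(* Let $(\mathscr{A},\ast,\alpha)$ be a Hom-anti-associative algebra. Then there exists a compatible Hom-rhizaform algebra structure on $(\mathscr{A},\ast,\alpha)$ if and only if there exists an invertible $\mathcal{O}$-operator of $(\mathscr{A},\ast,\alpha)$, i.e. there exist a bimodule $(V,l,r,\beta)$ over $(\mathscr{A},\ast,\alpha)$ and a bijective $\mathcal{O}$-operator $T:V\to\mathscr{A}$ of $(\mathscr{A},\ast,\alpha)$ associated to $(V,l,r,\beta)$.
   Context: All vector spaces are over a fixed field $\mathbb{F}$. A Hom-anti-associative algebra $(\mathscr{A},\ast,\alpha)$ is a vector space with a bilinear product $\ast$ and a linear map $\alpha:\mathscr{A}\to\mathscr{A}$ such that $\alpha(x)\ast(y\ast z)=-(x\ast y)\ast\alpha(z)$ for all $x,y,z$. A Hom-rhizaform algebra is a quadruple $(\mathscr{A},\succ,\prec,\alpha)$ with $\mathscr{A}$ a vector space, $\succ,\prec$ bilinear operations on $\mathscr{A}$ and $\alpha:\mathscr{A}\to\mathscr{A}$ linear such that for all $x,y,z\in\mathscr{A}$: $\alpha(x\prec y)=\alpha(x)\prec\alpha(y)$, $\alpha(x\succ y)=\alpha(x)\succ\alpha(y)$, and $$(x\succ y+x\prec y)\succ\alpha(z)=-\alpha(x)\succ(y\succ z),$$ $$\alpha(x)\prec(y\succ z+y\prec z)=-(x\prec y)\prec\alpha(z),$$ $$\alpha(x)\succ(y\prec z)=-(x\succ y)\prec\alpha(z).$$ It is a compatible Hom-rhizaform algebra structure on $(\mathscr{A},\ast,\alpha)$ if $x\ast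 y=x\succ y+x\prec y$ for all $x,y\in\mathscr{A}$ (same underlying space and same $\alpha$). A bimodule $(V,l,r,\beta)$ over $(\mathscr{A},\ast,\alpha)$ is a vector space $V$ with a linear map $\beta:V\to V$ and linear maps $l,r:\mathscr{A}\to\mathrm{End}(V)$ such that for all $a,b\in\mathscr{A}$, $m\in V$: $$l(\alpha(a))(l(b)(m))=-l(a\ast b)(\beta(m)),\quad r(\alpha(b))(r(a)(m))=-r(a\ast b)(\beta(m)),$$ $$l(\alpha(a))(r(b)(m))=-r(\alpha(b))(l(a)(m)),$$ $$\beta(l(a)(m))=l(\alpha(a))(\beta(m)),\quad \beta(r(a)(m))=r(\alpha(a))(\beta(m)).$$ An $\mathcal{O}$-operator of $(\mathscr{A},\ast,\alpha)$ associated to $(V,l,r,\beta)$ is a linear map $T:V\to\mathscr{A}$ with $T\circ\beta=\alpha\circ T$ and $T(u)\ast T(v)=T\big(l(T(u))(v)+r(T(v))(u)\big)$ for all $u,v\in V$. *)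

theory Defs
  imports "HOL-Algebra.Module"
begin

text \<open>
  A vector space over \<open>F\<close> is a \<open>module F V\<close> with \<open>field F\<close>; the multiplicative fields of the
  record \<open>V\<close> are never used. Products, actions and linear maps are only constrained on carriers.
\<close>

definition linear_on ::
    "('f, 'k) ring_scheme \<Rightarrow> ('f, 'v, 'm) module_scheme \<Rightarrow> ('f, 'w, 'n) module_scheme
      \<Rightarrow> ('v \<Rightarrow> 'w) \<Rightarrow> bool" where
  "linear_on F V W f \<longleftrightarrow>
     f \<in> carrier V \<rightarrow> carrier W \<and>
     (\<forall>x\<in>carrier V. \<forall>y\<in>carrier V. f (x \<oplus>\<^bsub>V\<^esub> y) = f x \<oplus>\<^bsub>W\<^esub> f y) \<and>
     (\<forall>c\<in>carrier F. \<forall>x\<in>carrier V. f (c \<odot>\<^bsub>V\<^esub> x) = c \<odot>\<^bsub>W\<^esub> f x)"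

definition bilinear_on ::
    "('f, 'k) ring_scheme \<Rightarrow> ('f, 'u, 'm) module_scheme \<Rightarrow> ('f, 'v, 'n) module_scheme
      \<Rightarrow> ('f, 'w, 'p) module_scheme \<Rightarrow> ('u \<Rightarrow> 'v \<Rightarrow> 'w) \<Rightarrow> bool" where
  "bilinear_on F U V W b \<longleftrightarrow>
     (\<forall>x\<in>carrier U. linear_on F V W (b x)) \<and>
     (\<forall>y\<in>carrier V. linear_on F U W (\<lambda>x. b x y))"

locale hom_anti_associative_algebra =
  field F + A: module F A
  for F :: "('f, 'k) ring_scheme" and A :: "('f, 'a, 'm) module_scheme" +
  fixes mul :: "'a \<Rightarrow> 'a \<Rightarrow> 'a"  (infixl "\<star>" 70)
    and alpha :: "'a \<Rightarrow> 'a"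
  assumes mul_bilinear: "bilinear_on F A A A mul"
    and alpha_linear: "linear_on F A A alpha"
    and hom_anti_assoc:
      "\<lbrakk>x \<in> carrier A; y \<in> carrier A; z \<in> carrier A\<rbrakk>
        \<Longrightarrow> alpha x \<star> (y \<star> z) = \<ominus>\<^bsub>A\<^esub> ((x \<star> y) \<star> alpha z)"

locale hom_rhizaform_algebra =
  field F + A: module F A
  for F :: "('f, 'k) ring_scheme" and A :: "('f, 'a, 'm) module_scheme" +
  fixes rsucc :: "'a \<Rightarrow> 'a \<Rightarrow> 'a"  (infixl "\<succ>" 70)
    and rprec :: "'a \<Rightarrow> 'a \<Rightarrow> 'a"  (infixl "\<prec>" 70)
    and alpha :: "'a \<Rightarrow> 'a"
  assumes rsucc_bilinear: "bilinear_on F A A A rsucc"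
    and rprec_bilinear: "bilinear_on F A A A rprec"
    and alpha_linear: "linear_on F A A alpha"
    and alpha_rprec:
      "\<lbrakk>x \<in> carrier A; y \<in> carrier A\<rbrakk> \<Longrightarrow> alpha (x \<prec> y) = alpha x \<prec> alpha y"
    and alpha_rsucc:
      "\<lbrakk>x \<in> carrier A; y \<in> carrier A\<rbrakk> \<Longrightarrow> alpha (x \<succ> y) = alpha x \<succ> alpha y"
    and rhiza_succ:
      "\<lbrakk>x \<in> carrier A; y \<in> carrier A; z \<in> carrier A\<rbrakk>
        \<Longrightarrow> ((x \<succ> y) \<oplus>\<^bsub>A\<^esub> (x \<prec> y)) \<succ> alpha z = \<ominus>\<^bsub>A\<^esub> (alpha x \<succ> (y \<succ> z))"
    and rhiza_prec:
      "\<lbrakk>x \<in> carrier A; y \<in> carrier A; z \<in> carrier A\<rbrakk>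
        \<Longrightarrow> alpha x \<prec> ((y \<succ> z) \<oplus>\<^bsub>A\<^esub> (y \<prec> z)) = \<ominus>\<^bsub>A\<^esub> ((x \<prec> y) \<prec> alpha z)"
    and rhiza_mixed:
      "\<lbrakk>x \<in> carrier A; y \<in> carrier A; z \<in> carrier A\<rbrakk>
        \<Longrightarrow> alpha x \<succ> (y \<prec> z) = \<ominus>\<^bsub>A\<^esub> ((x \<succ> y) \<prec> alpha z)"

definition compatible_hom_rhizaform ::
    "('f, 'k) ring_scheme \<Rightarrow> ('f, 'a, 'm) module_scheme \<Rightarrow> ('a \<Rightarrow> 'a \<Rightarrow> 'a) \<Rightarrow> ('a \<Rightarrow> 'a)
      \<Rightarrow> ('a \<Rightarrow> 'a \<Rightarrow> 'a) \<Rightarrow> ('a \<Rightarrow> 'a \<Rightarrow> 'a) \<Rightarrow> bool" where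
  "compatible_hom_rhizaform F A mul alpha rsucc rprec \<longleftrightarrow>
     hom_rhizaform_algebra F A rsucc rprec alpha \<and>
     (\<forall>x\<in>carrier A. \<forall>y\<in>carrier A. mul x y = rsucc x y \<oplus>\<^bsub>A\<^esub> rprec x y)"

text \<open>
  A linear map from \<open>A\<close> to \<open>End(V)\<close>, whose vector space operations are pointwise, is encoded by
  its curried form, a bilinear map from \<open>A\<close> and \<open>V\<close> to \<open>V\<close>.
\<close>

locale hom_bimodule =
  hom_anti_associative_algebra F A mul alpha + V: module F V
  for F :: "('f, 'k) ring_scheme" and A :: "('f, 'a, 'm) module_scheme"
    and mul :: "'a \<Rightarrow> 'a \<Rightarrow> 'a"  (infixl "\<star>" 70) and alpha :: "'a \<Rightarrow> 'a"
    and V :: "('f, 'v, 'n) module_scheme" +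
  fixes l :: "'a \<Rightarrow> 'v \<Rightarrow> 'v" and r :: "'a \<Rightarrow> 'v \<Rightarrow> 'v" and beta :: "'v \<Rightarrow> 'v"
  assumes l_linear: "bilinear_on F A V V l"
    and r_linear: "bilinear_on F A V V r"
    and beta_linear: "linear_on F V V beta"
    and l_l:
      "\<lbrakk>a \<in> carrier A; b \<in> carrier A; m \<in> carrier V\<rbrakk>
        \<Longrightarrow> l (alpha a) (l b m) = \<ominus>\<^bsub>V\<^esub> (l (a \<star> b) (beta m))"
    and r_r:
      "\<lbrakk>a \<in> carrier A; b \<in> carrier A; m \<in> carrier V\<rbrakk>
        \<Longrightarrow> r (alpha b) (r a m) = \<ominus>\<^bsub>V\<^esub> (r (a \<star> b) (beta m))"
    and l_r:
      "\<lbrakk>a \<in> carrier A; b \<in> carrier A; m \<in> carrier V\<rbrakk>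
        \<Longrightarrow> l (alpha a) (r b m) = \<ominus>\<^bsub>V\<^esub> (r (alpha b) (l a m))"
    and beta_l:
      "\<lbrakk>a \<in> carrier A; m \<in> carrier V\<rbrakk> \<Longrightarrow> beta (l a m) = l (alpha a) (beta m)"
    and beta_r:
      "\<lbrakk>a \<in> carrier A; m \<in> carrier V\<rbrakk> \<Longrightarrow> beta (r a m) = r (alpha a) (beta m)"

locale hom_O_operator =
  hom_bimodule F A mul alpha V l r beta
  for F :: "('f, 'k) ring_scheme" and A :: "('f, 'a, 'm) module_scheme"
    and mul :: "'a \<Rightarrow> 'a \<Rightarrow> 'a"  (infixl "\<star>" 70) and alpha :: "'a \<Rightarrow> 'a"
    and V :: "('f, 'v, 'n) module_scheme"
    and l :: "'a \<Rightarrow> 'v \<Rightarrow> 'v" and r :: "'a \<Rightarrow> 'v \<Rightarrow> 'v" and beta :: "'v \<Rightarrow> 'v" +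
  fixes T :: "'v \<Rightarrow> 'a"
  assumes T_linear: "linear_on F V A T"
    and T_beta: "u \<in> carrier V \<Longrightarrow> T (beta u) = alpha (T u)"
    and T_mul:
      "\<lbrakk>u \<in> carrier V; v \<in> carrier V\<rbrakk>
        \<Longrightarrow> T u \<star> T v = T (l (T u) v \<oplus>\<^bsub>V\<^esub> r (T v) u)"

definition invertible_O_operator ::
    "('f, 'k) ring_scheme \<Rightarrow> ('f, 'a, 'm) module_scheme \<Rightarrow> ('a \<Rightarrow> 'a \<Rightarrow> 'a) \<Rightarrow> ('a \<Rightarrow> 'a)
      \<Rightarrow> ('f, 'v, 'n) module_scheme \<Rightarrow> ('a \<Rightarrow> 'v \<Rightarrow> 'v) \<Rightarrow> ('a \<Rightarrow> 'v \<Rightarrow> 'v) \<Rightarrow> ('v \<Rightarrow> 'v)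
      \<Rightarrow> ('v \<Rightarrow> 'a) \<Rightarrow> bool" where
  "invertible_O_operator F A mul alpha V l r beta T \<longleftrightarrow>
     hom_O_operator F A mul alpha V l r beta T \<and> bij_betw T (carrier V) (carrier A)"

end

theory Submission
  imports Defs
begin

text \<open>
  An \<open>\<O>\<close>-operator \<open>T\<close> always splits the product on its image: \<open>T u \<star> T v\<close> is the sum of
  \<open>T (l (T u) v)\<close> and \<open>T (r (T v) u)\<close>. If \<open>T\<close> is invertible with inverse \<open>S\<close>, these two summands
  are operations on the whole of \<open>A\<close>, namely \<open>x \<succ> y = T (l x (S y))\<close> and \<open>x \<prec> y = T (r y (S x))\<close>.
  Since \<open>S\<close> intertwines \<open>alpha\<close> with \<open>beta\<close>, conjugation by \<open>T\<close> turns the three associativity-like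
  laws of the bimodule into the three Hom-rhizaform identities, and the equivariance of \<open>l\<close> and \<open>r\<close>
  under \<open>beta\<close> into the multiplicativity of \<open>alpha\<close>. This is
  \<open>compatible_hom_rhizaform_of_O_operator\<close>; it works for a representation space of any type.

  Conversely, a compatible Hom-rhizaform structure makes \<open>A\<close> a bimodule over itself, where \<open>x\<close> acts
  from the left by \<open>\<lambda>y. x \<succ> y\<close> and from the right by \<open>\<lambda>y. y \<prec> x\<close>, and with \<open>beta = alpha\<close>. The
  identity is then an invertible \<open>\<O>\<close>-operator, because its defining equation is precisely
  compatibility: \<open>invertible_O_operator_of_compatible\<close>.
\<close>

lemma linear_on_closed:
  "linear_on F V W f \<Longrightarrow> x \<in> carrier V \<Longrightarrow> f x \<in> carrier W"
  by (auto simp: linear_on_def)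

lemma linear_on_add:
  "linear_on F V W f \<Longrightarrow> x \<in> carrier V \<Longrightarrow> y \<in> carrier V
    \<Longrightarrow> f (x \<oplus>\<^bsub>V\<^esub> y) = f x \<oplus>\<^bsub>W\<^esub> f y"
  by (auto simp: linear_on_def)

lemma linear_on_uminus:
  assumes "module F V" "module F W" "linear_on F V W f" "x \<in> carrier V"
  shows "f (\<ominus>\<^bsub>V\<^esub> x) = \<ominus>\<^bsub>W\<^esub> f x"
proof -
  interpret V: module F V by fact
  interpret W: module F W by fact
  have "f ((\<ominus>\<^bsub>F\<^esub> \<one>\<^bsub>F\<^esub>) \<odot>\<^bsub>V\<^esub> x) = (\<ominus>\<^bsub>F\<^esub> \<one>\<^bsub>F\<^esub>) \<odot>\<^bsub>W\<^esub> f x"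
    using assms(3,4) by (simp add: linear_on_def)
  then show ?thesis
    using assms(4) linear_on_closed[OF assms(3,4)]
    by (simp add: V.smult_l_minus W.smult_l_minus)
qed

lemma linear_on_compose:
  assumes "linear_on F U V f" "linear_on F V W g"
  shows "linear_on F U W (\<lambda>x. g (f x))"
  using assms by (simp add: linear_on_def Pi_iff)

lemma linear_on_id: "linear_on F V V (\<lambda>x. x)"
  by (simp add: linear_on_def)

lemma linear_on_inv_into:
  assumes "module F V" "linear_on F V W f" "bij_betw f (carrier V) (carrier W)"
  shows "linear_on F W V (inv_into (carrier V) f)"
proof -
  interpret V: module F V by fact
  let ?g = "inv_into (carrier V) f"
  have inj: "inj_on f (carrier V)" using assms(3) by (rule bij_betw_imp_inj_on)
  have g: "?g y \<in> carrier V" "f (?g y) = y" if "y \<in> carrier W" for y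
    using assms(3) that
    by (auto simp: bij_betw_def inv_into_into f_inv_into_f)
  have add: "?g (x \<oplus>\<^bsub>W\<^esub> y) = ?g x \<oplus>\<^bsub>V\<^esub> ?g y" if "x \<in> carrier W" "y \<in> carrier W" for x y
  proof (rule inv_into_f_eq[OF inj])
    show "f (?g x \<oplus>\<^bsub>V\<^esub> ?g y) = x \<oplus>\<^bsub>W\<^esub> y"
      using assms(2) g that by (simp add: linear_on_add)
  qed (use g that in simp)
  have smult: "?g (c \<odot>\<^bsub>W\<^esub> x) = c \<odot>\<^bsub>V\<^esub> ?g x" if "c \<in> carrier F" "x \<in> carrier W" for c x
  proof (rule inv_into_f_eq[OF inj])
    show "f (c \<odot>\<^bsub>V\<^esub> ?g x) = c \<odot>\<^bsub>W\<^esub> x"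
      using assms(2) g that by (simp add: linear_on_def)
  qed (use g that in simp)
  show ?thesis
    using g(1) add smult by (simp add: linear_on_def)
qed

lemma bilinear_onD:
  assumes "bilinear_on F U V W b"
  shows "x \<in> carrier U \<Longrightarrow> linear_on F V W (b x)"
    and "y \<in> carrier V \<Longrightarrow> linear_on F U W (\<lambda>x. b x y)"
  using assms by (auto simp: bilinear_on_def)

lemma bilinear_on_closed:
  "bilinear_on F U V W b \<Longrightarrow> x \<in> carrier U \<Longrightarrow> y \<in> carrier V \<Longrightarrow> b x y \<in> carrier W"
  using bilinear_onD(1) linear_on_closed by metis

lemma bilinear_on_flip:
  "bilinear_on F U V W b \<Longrightarrow> bilinear_on F V U W (\<lambda>y x. b x y)"
  by (simp add: bilinear_on_def)

lemma bilinear_on_compose: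
  assumes b: "bilinear_on F U V W b"
    and f: "linear_on F V' V f" and g: "linear_on F W W' g"
  shows "bilinear_on F U V' W' (\<lambda>x y. g (b x (f y)))"
  unfolding bilinear_on_def
  using linear_on_compose[OF linear_on_compose[OF f bilinear_onD(1)[OF b]] g]
    linear_on_compose[OF bilinear_onD(2)[OF b linear_on_closed[OF f]] g]
  by blast

context hom_O_operator
begin

lemma compatible_hom_rhizaform_of_O_operator:
  assumes bij: "bij_betw T (carrier V) (carrier A)"
  defines "S \<equiv> inv_into (carrier V) T"
  shows "compatible_hom_rhizaform F A mul alpha (\<lambda>x y. T (l x (S y))) (\<lambda>x y. T (r y (S x)))"
proof -
  have S_linear: "linear_on F A V S"
    unfolding S_def by (rule linear_on_inv_into[OF V.module_axioms T_linear bij])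
  note closed [simp] = linear_on_closed[OF S_linear] linear_on_closed[OF T_linear]
    linear_on_closed[OF alpha_linear] linear_on_closed[OF beta_linear]
    bilinear_on_closed[OF l_linear] bilinear_on_closed[OF r_linear]
    bilinear_on_closed[OF mul_bilinear]
  have TS [simp]: "T (S x) = x" if "x \<in> carrier A" for x
    using bij that by (simp add: S_def bij_betw_def f_inv_into_f)
  have ST [simp]: "S (T v) = v" if "v \<in> carrier V" for v
    using bij that by (simp add: S_def bij_betw_def)
  \<comment> \<open>Without this, \<open>S (alpha z)\<close> would not meet the \<open>beta\<close> on the right of the bimodule laws.\<close>
  have S_alpha: "S (alpha x) = beta (S x)" if "x \<in> carrier A" for x
    using that T_beta[of "S x"] ST[of "beta (S x)"] by simp
  have T_uminus: "T (\<ominus>\<^bsub>V\<^esub> v) = \<ominus>\<^bsub>A\<^esub> T v" if "v \<in> carrier V" for v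
    by (rule linear_on_uminus[OF V.module_axioms A.module_axioms T_linear that])
  \<comment> \<open>Besides giving compatibility, this collapses the sums inside the Hom-rhizaform identities to
    products \<open>x \<star> y\<close>, the form in which the left and right action laws \<open>l_l\<close> and \<open>r_r\<close> apply.\<close>
  have split: "T (l x (S y)) \<oplus>\<^bsub>A\<^esub> T (r y (S x)) = x \<star> y"
    if "x \<in> carrier A" "y \<in> carrier A" for x y
    using that T_mul[of "S x" "S y"] by (simp add: linear_on_add[OF T_linear])
  have "hom_rhizaform_algebra F A (\<lambda>x y. T (l x (S y))) (\<lambda>x y. T (r y (S x))) alpha"
  proof unfold_locales
    show "bilinear_on F A A A (\<lambda>x y. T (l x (S y)))"
      by (rule bilinear_on_compose[OF l_linear S_linear T_linear])
    show "bilinear_on F A A A (\<lambda>x y. T (r y (S x)))"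
      by (rule bilinear_on_flip[OF bilinear_on_compose[OF r_linear S_linear T_linear]])
    show "linear_on F A A alpha" by (rule alpha_linear)
  next
    fix x y assume xy: "x \<in> carrier A" "y \<in> carrier A"
    show "alpha (T (r y (S x))) = T (r (alpha y) (S (alpha x)))"
      using xy by (simp add: S_alpha beta_r T_beta[symmetric])
    show "alpha (T (l x (S y))) = T (l (alpha x) (S (alpha y)))"
      using xy by (simp add: S_alpha beta_l T_beta[symmetric])
  next
    fix x y z assume xyz: "x \<in> carrier A" "y \<in> carrier A" "z \<in> carrier A"
    show "T (l (T (l x (S y)) \<oplus>\<^bsub>A\<^esub> T (r y (S x))) (S (alpha z)))
        = \<ominus>\<^bsub>A\<^esub> T (l (alpha x) (S (T (l y (S z)))))"
      using xyz by (simp add: split S_alpha l_l T_uminus)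
    show "T (r (T (l y (S z)) \<oplus>\<^bsub>A\<^esub> T (r z (S y))) (S (alpha x)))
        = \<ominus>\<^bsub>A\<^esub> T (r (alpha z) (S (T (r y (S x)))))"
      using xyz by (simp add: split S_alpha r_r T_uminus)
    show "T (l (alpha x) (S (T (r z (S y))))) = \<ominus>\<^bsub>A\<^esub> T (r (alpha z) (S (T (l x (S y)))))"
      using xyz by (simp add: l_r T_uminus)
  qed
  then show ?thesis
    by (simp add: compatible_hom_rhizaform_def split)
qed

end

lemma invertible_O_operator_of_compatible:
  assumes "hom_anti_associative_algebra F A mul alpha"
    and "compatible_hom_rhizaform F A mul alpha rsucc rprec"
  shows "invertible_O_operator F A mul alpha A rsucc (\<lambda>x y. rprec y x) alpha (\<lambda>x. x)"
proof -
  interpret hom_anti_associative_algebra F A mul alpha by fact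
  interpret R: hom_rhizaform_algebra F A rsucc rprec alpha
    using assms(2) by (simp add: compatible_hom_rhizaform_def)
  have mul: "mul x y = rsucc x y \<oplus>\<^bsub>A\<^esub> rprec x y" if "x \<in> carrier A" "y \<in> carrier A" for x y
    using assms(2) that by (simp add: compatible_hom_rhizaform_def)
  note closed [simp] = linear_on_closed[OF alpha_linear]
    bilinear_on_closed[OF R.rsucc_bilinear] bilinear_on_closed[OF R.rprec_bilinear]
  have "hom_O_operator F A mul alpha A rsucc (\<lambda>x y. rprec y x) alpha (\<lambda>x. x)"
  proof unfold_locales
    show "bilinear_on F A A A rsucc" by (rule R.rsucc_bilinear)
    show "bilinear_on F A A A (\<lambda>x y. rprec y x)"
      by (rule bilinear_on_flip[OF R.rprec_bilinear])
    show "linear_on F A A (\<lambda>x. x)" by (rule linear_on_id)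
  qed (simp_all add: mul alpha_linear R.rhiza_succ R.rhiza_prec R.rhiza_mixed
      R.alpha_rsucc R.alpha_rprec)
  then show ?thesis
    by (simp add: invertible_O_operator_def bij_betw_def)
qed

theorem theorem3p4:
  fixes F :: "('f, 'k) ring_scheme" and A :: "('f, 'a) module"
    and mul :: "'a \<Rightarrow> 'a \<Rightarrow> 'a" and alpha :: "'a \<Rightarrow> 'a"
  assumes "hom_anti_associative_algebra F A mul alpha"
  shows "((\<exists>rsucc rprec. compatible_hom_rhizaform F A mul alpha rsucc rprec) \<longleftrightarrow>
          (\<exists>(V :: ('f, 'a) module) l r beta T.
             invertible_O_operator F A mul alpha V l r beta T)) \<and>
         ((\<exists>(W :: ('f, 'w) module) l r beta T.
             invertible_O_operator F A mul alpha W l r beta T) \<longrightarrow>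
          (\<exists>rsucc rprec. compatible_hom_rhizaform F A mul alpha rsucc rprec))"
proof -
  have to_O: "\<exists>(V :: ('f, 'a) module) l r beta T. invertible_O_operator F A mul alpha V l r beta T"
    if "compatible_hom_rhizaform F A mul alpha rsucc rprec" for rsucc rprec
    using invertible_O_operator_of_compatible[OF assms that] by blast
  \<comment> \<open>The same argument is instantiated at the two types of representation spaces, since a fact
    is not polymorphic inside a proof.\<close>
  have from_O: "\<exists>rsucc rprec. compatible_hom_rhizaform F A mul alpha rsucc rprec"
    if "invertible_O_operator F A mul alpha V l r beta T" for V :: "('f, 'a) module" and l r beta T
    using that hom_O_operator.compatible_hom_rhizaform_of_O_operator
    unfolding invertible_O_operator_def by blast
  have from_O': "\<exists>rsucc rprec. compatible_hom_rhizaform F A mul alpha rsucc rprec"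
    if "invertible_O_operator F A mul alpha W l r beta T" for W :: "('f, 'w) module" and l r beta T
    using that hom_O_operator.compatible_hom_rhizaform_of_O_operator
    unfolding invertible_O_operator_def by blast
  show ?thesis
    using to_O from_O from_O' by blast
qed

end
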